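(* Let $\mathcal{M}$ be a moon polyomino with $n$ rows and $m$ columns, and let $\mathbf{e}\in\{0,1\}^n$ and $\mathbf{s}\in\mathbb{N}^m$ satisfy $\sum_i \varepsilon_i=\sum_j s_j$. For $S\subseteq[n]$ define $$F^t_S(p,q)=\sum_{M\in\mathbf{F}(\mathcal{M},\mathbf{e},\mathbf{s})} p^{\alpha(S;M)}q^{\alpha(\bar S;M)},\qquad F^b_S(p,q)=\sum_{M\in\mathbf{F}(\mathcal{M},\mathbf{e},\mathbf{s})} p^{\beta(S;M)}q^{\beta(\bar S;M)},$$ where $\bar S=[n]\setminus S$. Then $F^t_S(p,q)=F^t_{S'}(p,q)$ for any two subsets $S,S'\subseteq[n]$; consequently $$F^t_S(p,q)=F^t_\emptyset(p,q)=\sum_{M\in\mathbf{F}(\mathcal{M},\mathbf{e},\mathbf{s})}p^{\mathrm{se}(M)}q^{\mathrm{ne}(M)},$$ and this is a symmetric function of $p,q$ (i.e. invariant under exchanging $p$ and $q$). The same statements hold for $F^b_S(p,q)$.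
   Context: A polyomino is a finite set of unit square cells in $\mathbb{Z}^2$. It is convex if its intersection with every row and every column is connected, and intersection-free if any two columns are comparable (the set of rows met by one column is contained in the set of rows met by the other). A moon polyomino is a convex, intersection-free polyomino. Label its rows $R_1,\dots,R_n$ from top to bottom and its columns $C_1,\dots,C_m$ from left to right. A filling is an assignment of $0$ or $1$ to each cell such that each row contains at most one $1$; a cell containing $1$ is a $1$-cell. For $\mathbf{e}=(\varepsilon_1,\dots,\varepsilon_n)\in\{0,1\}^n$ and $\mathbf{s}=(s_1,\dots,s_m)\in\mathbb{N}^m$, $\mathbf{F}(\mathcal{M},\mathbf{e},\mathbf{s})$ is the set of fillings in which row $R_i$ contains exactly $\varepsilon_i$ ones and column $C_j$ contains exactly $s_j$ ones. A northeast (NE) chain (resp. southeast (SE) chain) of a filling $M$ is a set of two $1$-cells such that one is strictly above (resp. strictly below) and strictly to the right of the other, and the smallest rectangle containing both is contained in $\mathcal{M}$. $\mathrm{ne}(M)$ and $\mathrm{se}(M)$ denote the numbers of NE and SE chains. For $S\subseteq[n]$, let $\mathcal{R}(S)=\bigcup_{i\in S}R_i$. Define $\alpha(S;M)$ as the number of NE chains whose upper $1$-cell lies in $\mathcal{R}(S)$ plus the number of SE chains whose upper $1$-cell lies in $\mathcal{R}(\bar S)$; define $\beta(S;M)$ as the number of NE chains whose lower $1$-cell lies in $\mathcal{R}(S)$ plus the number of SE chains whose lower $1$-cell lies in $\mathcal{R}(\bar S)$. *)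

theory Defs
  imports Main "HOL-Library.FuncSet"
begin

text \<open>
  A cell is written in matrix coordinates \<open>(row, column)\<close>: the first coordinate increases
  from top to bottom, the second one from left to right.
\<close>

type_synonym cell = "int \<times> int"

definition polyomino :: "cell set \<Rightarrow> bool" where
  "polyomino P \<longleftrightarrow> finite P"

definition hv_convex :: "cell set \<Rightarrow> bool" where
  "hv_convex P \<longleftrightarrow>
     (\<forall>r c c' k. (r, c) \<in> P \<and> (r, c') \<in> P \<and> c \<le> k \<and> k \<le> c' \<longrightarrow> (r, k) \<in> P) \<and>
     (\<forall>c r r' k. (r, c) \<in> P \<and> (r', c) \<in> P \<and> r \<le> k \<and> k \<le> r' \<longrightarrow> (k, c) \<in> P)"

definition intersection_free :: "cell set \<Rightarrow> bool" where
  "intersection_free P \<longleftrightarrow>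
     (\<forall>c c'. {r. (r, c) \<in> P} \<subseteq> {r. (r, c') \<in> P} \<or> {r. (r, c') \<in> P} \<subseteq> {r. (r, c) \<in> P})"

definition moon_polyomino :: "cell set \<Rightarrow> bool" where
  "moon_polyomino P \<longleftrightarrow> polyomino P \<and> hv_convex P \<and> intersection_free P"

definition num_rows :: "cell set \<Rightarrow> nat" where
  "num_rows P = card (fst ` P)"

definition num_cols :: "cell set \<Rightarrow> nat" where
  "num_cols P = card (snd ` P)"

text \<open>
  The nonempty rows are labelled \<open>1, \<dots>, num_rows P\<close> from top to bottom and the nonempty
  columns \<open>1, \<dots>, num_cols P\<close> from left to right; the values at other labels are irrelevant.
\<close>

definition row :: "cell set \<Rightarrow> nat \<Rightarrow> cell set" where
  "row P i = {x \<in> P. fst x = sorted_list_of_set (fst ` P) ! (i - 1)}"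

definition col :: "cell set \<Rightarrow> nat \<Rightarrow> cell set" where
  "col P j = {x \<in> P. snd x = sorted_list_of_set (snd ` P) ! (j - 1)}"

definition rows_of :: "cell set \<Rightarrow> nat set \<Rightarrow> cell set" where
  "rows_of P S = (\<Union>i\<in>S. row P i)"

definition one_cells :: "cell set \<Rightarrow> (cell \<Rightarrow> nat) \<Rightarrow> cell set" where
  "one_cells P f = {x \<in> P. f x = 1}"

definition fillings :: "cell set \<Rightarrow> (cell \<Rightarrow> nat) set" where
  "fillings P =
     {f \<in> P \<rightarrow>\<^sub>E {0, 1}. \<forall>i\<in>{1..num_rows P}. card (one_cells P f \<inter> row P i) \<le> 1}"

definition fillings_with :: "cell set \<Rightarrow> (nat \<Rightarrow> nat) \<Rightarrow> (nat \<Rightarrow> nat) \<Rightarrow> (cell \<Rightarrow> nat) set" where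
  "fillings_with P e s =
     {f \<in> fillings P.
        (\<forall>i\<in>{1..num_rows P}. card (one_cells P f \<inter> row P i) = e i) \<and>
        (\<forall>j\<in>{1..num_cols P}. card (one_cells P f \<inter> col P j) = s j)}"

definition bounding_rectangle :: "cell \<Rightarrow> cell \<Rightarrow> cell set" where
  "bounding_rectangle x y =
     {min (fst x) (fst y)..max (fst x) (fst y)} \<times> {min (snd x) (snd y)..max (snd x) (snd y)}"

text \<open>
  A chain, a set of two 1-cells lying in different rows, is represented by the ordered pair
  \<open>(upper cell, lower cell)\<close>.
\<close>

definition ne_chains :: "cell set \<Rightarrow> (cell \<Rightarrow> nat) \<Rightarrow> (cell \<times> cell) set" where
  "ne_chains P f =
     {(u, l). u \<in> one_cells P f \<and> l \<in> one_cells P f \<and> fst u < fst l \<and> snd l < snd u \<and>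
              bounding_rectangle u l \<subseteq> P}"

definition se_chains :: "cell set \<Rightarrow> (cell \<Rightarrow> nat) \<Rightarrow> (cell \<times> cell) set" where
  "se_chains P f =
     {(u, l). u \<in> one_cells P f \<and> l \<in> one_cells P f \<and> fst u < fst l \<and> snd u < snd l \<and>
              bounding_rectangle u l \<subseteq> P}"

definition ne :: "cell set \<Rightarrow> (cell \<Rightarrow> nat) \<Rightarrow> nat" where
  "ne P f = card (ne_chains P f)"

definition se :: "cell set \<Rightarrow> (cell \<Rightarrow> nat) \<Rightarrow> nat" where
  "se P f = card (se_chains P f)"

definition compl_rows :: "cell set \<Rightarrow> nat set \<Rightarrow> nat set" where
  "compl_rows P S = {1..num_rows P} - S"

definition alpha :: "cell set \<Rightarrow> nat set \<Rightarrow> (cell \<Rightarrow> nat) \<Rightarrow> nat" where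
  "alpha P S f =
     card {(u, l) \<in> ne_chains P f. u \<in> rows_of P S} +
     card {(u, l) \<in> se_chains P f. u \<in> rows_of P (compl_rows P S)}"

definition beta :: "cell set \<Rightarrow> nat set \<Rightarrow> (cell \<Rightarrow> nat) \<Rightarrow> nat" where
  "beta P S f =
     card {(u, l) \<in> ne_chains P f. l \<in> rows_of P S} +
     card {(u, l) \<in> se_chains P f. l \<in> rows_of P (compl_rows P S)}"

text \<open>
  The generating functions are evaluated at elements of an arbitrary commutative semiring; an
  identity valid for all such elements is in particular one of polynomials in two indeterminates
  (take the semiring to be \<open>nat poly poly\<close>).
\<close>

definition F_top ::
    "cell set \<Rightarrow> (nat \<Rightarrow> nat) \<Rightarrow> (nat \<Rightarrow> nat) \<Rightarrow> nat set \<Rightarrow> 'a \<Rightarrow> 'a \<Rightarrow> 'a::comm_semiring_1" where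
  "F_top P e s S p q =
     (\<Sum>f\<in>fillings_with P e s. p ^ alpha P S f * q ^ alpha P (compl_rows P S) f)"

definition F_bot ::
    "cell set \<Rightarrow> (nat \<Rightarrow> nat) \<Rightarrow> (nat \<Rightarrow> nat) \<Rightarrow> nat set \<Rightarrow> 'a \<Rightarrow> 'a \<Rightarrow> 'a::comm_semiring_1" where
  "F_bot P e s S p q =
     (\<Sum>f\<in>fillings_with P e s. p ^ beta P S f * q ^ beta P (compl_rows P S) f)"

end

theory Submission
  imports Defs
begin

text \<open>
  A filling assigns a column to every row \<open>r\<close> with \<open>e r = 1\<close>. Peel off an outermost column whose
  row set \<open>V\<close> is contained in the row set of every other column; such a column exists because the
  first and the last column are comparable and rows are convex. If the column holds ones in the
  rows \<open>A \<subseteq> V\<close>, then every occupied row of \<open>V - A\<close> has its 1-cell on the same known side of the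
  column and forms a chain with each row of \<open>A\<close>. Hence the contribution of the column is a sum over
  the \<open>k\<close>-subsets \<open>A\<close> of \<open>V\<close>, which is evaluated by removing the first row (when the upper cell
  decides the weight) or the last row (when the lower cell does). Membership of that row in \<open>S\<close> only
  exchanges \<open>p\<close> and \<open>q\<close> in the recursion, and the \<open>p,q\<close>-binomial coefficients satisfy both
  resulting Pascal recursions. So the sum depends on neither \<open>S\<close> nor the positions of the rows, only on their number. Symmetry
  in \<open>p\<close> and \<open>q\<close> follows, as exchanging them amounts to complementing \<open>S\<close>.
\<close>

section \<open>The \<open>p,q\<close>-binomial coefficients\<close>

text \<open>A Pascal recursion replaces the usual quotient of \<open>p,q\<close>-factorials because
  the values lie in a semiring, without subtraction or division. The truncated difference
  \<open>h - k\<close> is harmless: for \<open>h < k\<close> its cofactor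
  \<open>pqbin p q h k\<close> is zero.\<close>

fun pqbin :: "'a \<Rightarrow> 'a \<Rightarrow> nat \<Rightarrow> nat \<Rightarrow> 'a::comm_semiring_1" where
  "pqbin p q 0 0 = 1"
| "pqbin p q 0 (Suc k) = 0"
| "pqbin p q (Suc h) 0 = 1"
| "pqbin p q (Suc h) (Suc k) = p ^ (h - k) * pqbin p q h k + q ^ Suc k * pqbin p q h (Suc k)"

lemma pqbin_0 [simp]: "pqbin p q h 0 = 1"
  by (cases h) auto

lemma pqbin_eq_0: "h < k \<Longrightarrow> pqbin p q h k = 0"
  by (induction p q h k rule: pqbin.induct) auto

text \<open>This is the defining recursion with \<open>p\<close> and \<open>q\<close> exchanged, so
  it expresses the symmetry of the coefficients. Expanding by the definition and then by the
  induction hypothesis gives four terms, which regroup into the expansion taken in the opposite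
  order.\<close>

lemma pqbin_Pascal:
  "pqbin p q (Suc h) (Suc k) = q ^ (h - k) * pqbin p q h k + p ^ Suc k * pqbin p q h (Suc k)"
proof (induction h arbitrary: k)
  case 0
  show ?case by (cases k) auto
next
  case (Suc h)
  show ?case
  proof (cases k)
    case 0
    let ?b = "pqbin p q h (Suc 0)"
    have "pqbin p q (Suc (Suc h)) (Suc 0) = p ^ Suc h + q * pqbin p q (Suc h) (Suc 0)"
      by simp
    also have "\<dots> = p ^ Suc h + q * (q ^ h + p * ?b)"
      unfolding Suc.IH by simp
    also have "\<dots> = q ^ Suc h + p * (p ^ h + q * ?b)"
      by (simp add: distrib_left mult_ac add_ac)
    also have "\<dots> = q ^ Suc h + p * pqbin p q (Suc h) (Suc 0)"
      by simp
    finally show ?thesis unfolding 0 by simp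
  next
    case (Suc j)
    let ?b = "pqbin p q"
    have rec1: "?b (Suc h) (Suc i) = p ^ (h - i) * ?b h i + q ^ Suc i * ?b h (Suc i)" for i
      by simp
    \<comment> \<open>Both exponent sums are \<open>h + 1\<close> if \<open>j < h\<close>. Otherwise
      truncated subtraction can make them differ, so the factor \<open>?b h (Suc j)\<close>, which
      is then zero, is kept in the equation.\<close>
    have mid: "x ^ (h - j) * x ^ Suc j * ?b h (Suc j) = x ^ Suc k * x ^ (h - Suc j) * ?b h (Suc j)" for x
    proof (cases "j < h")
      case True
      then have "h - j + Suc j = Suc k + (h - Suc j)" using Suc by simp
      then show ?thesis by (metis power_add)
    qed (simp add: pqbin_eq_0)
    have "?b (Suc (Suc h)) (Suc k) = p ^ (h - j) * ?b (Suc h) (Suc j) + q ^ Suc k * ?b (Suc h) (Suc k)"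
      using Suc by simp
    also have "\<dots> = p ^ (h - j) * (q ^ (h - j) * ?b h j + p ^ Suc j * ?b h (Suc j))
        + q ^ Suc k * (q ^ (h - k) * ?b h k + p ^ Suc k * ?b h (Suc k))"
      unfolding Suc.IH ..
    also have "\<dots> = p ^ (h - j) * q ^ (h - j) * ?b h j + p ^ (h - j) * p ^ Suc j * ?b h (Suc j)
        + (q ^ Suc k * q ^ (h - Suc j) * ?b h (Suc j) + q ^ Suc k * p ^ Suc k * ?b h (Suc k))"
      using Suc by (simp only: distrib_left mult.assoc)
    also have "\<dots> = q ^ (h - j) * (p ^ (h - j) * ?b h j + q ^ Suc j * ?b h (Suc j))
        + p ^ Suc k * (p ^ (h - k) * ?b h k + q ^ Suc k * ?b h (Suc k))"
      unfolding distrib_left mult.assoc[symmetric] mid[of p] mid[of q, symmetric]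
      using Suc by (simp only: add_ac mult_ac)
    also have "\<dots> = q ^ (Suc h - k) * ?b (Suc h) k + p ^ Suc k * ?b (Suc h) (Suc k)"
      unfolding rec1[symmetric] using Suc by simp
    finally show ?thesis .
  qed
qed

section \<open>The weight of a single column\<close>

text \<open>
  \<open>t r r'\<close> tells whether an NE chain with upper row \<open>r\<close> and lower row \<open>r'\<close> has weight \<open>p\<close> rather than
  \<open>q\<close>; an SE chain in these rows has the other weight. In \<open>column_weight\<close>, the column to the left of
  all others has its ones in the rows \<open>A\<close>.
\<close>
definition column_weight ::
    "'a \<Rightarrow> 'a \<Rightarrow> ('r::linorder \<Rightarrow> 'r \<Rightarrow> bool) \<Rightarrow> 'r set \<Rightarrow> 'r set \<Rightarrow> 'a::comm_semiring_1" where
  "column_weight p q t V A =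
     (\<Prod>(r, r')\<in>{(r, r'). r \<in> V \<and> r' \<in> V \<and> r < r' \<and> (r \<in> A) \<noteq> (r' \<in> A)}.
        if (r' \<in> A) = t r r' then p else q)"

text \<open>The first alternative serves \<open>alpha\<close>, where the upper row decides, and the
  second serves \<open>beta\<close>, where the lower row decides; both statistics are thus handled
  by one argument.\<close>

definition one_sided :: "('r \<Rightarrow> 'r \<Rightarrow> bool) \<Rightarrow> bool" where
  "one_sided t \<longleftrightarrow> (\<exists>T. t = (\<lambda>r r'. r \<in> T)) \<or> (\<exists>T. t = (\<lambda>r r'. r' \<in> T))"

text \<open>For a peeled column to the right of all others, NE and SE chains change roles, which
  negates \<open>t\<close>.\<close>

lemma one_sided_not: "one_sided t \<Longrightarrow> one_sided (\<lambda>r r'. \<not> t r r')"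
  unfolding one_sided_def
proof (elim disjE exE)
  fix T assume "t = (\<lambda>r r'. r \<in> T)"
  then have "(\<lambda>r r'. \<not> t r r') = (\<lambda>r r'. r \<in> - T)" by auto
  then show "(\<exists>T. (\<lambda>r r'. \<not> t r r') = (\<lambda>r r'. r \<in> T)) \<or> (\<exists>T. (\<lambda>r r'. \<not> t r r') = (\<lambda>r r'. r' \<in> T))"
    by blast
next
  fix T assume "t = (\<lambda>r r'. r' \<in> T)"
  then have "(\<lambda>r r'. \<not> t r r') = (\<lambda>r r'. r' \<in> - T)" by auto
  then show "(\<exists>T. (\<lambda>r r'. \<not> t r r') = (\<lambda>r r'. r \<in> T)) \<or> (\<exists>T. (\<lambda>r r'. \<not> t r r') = (\<lambda>r r'. r' \<in> T))"
    by blast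
qed

lemma column_weight_insert:
  assumes "finite V" "v \<notin> V"
  shows "column_weight p q t (insert v V) A =
           (\<Prod>u\<in>{u \<in> V. (u \<in> A) \<noteq> (v \<in> A)}.
              if v < u then (if (u \<in> A) = t v u then p else q)
              else (if (v \<in> A) = t u v then p else q)) * column_weight p q t V A"
proof -
  let ?D = "\<lambda>V. {(r, r'). r \<in> V \<and> r' \<in> V \<and> r < r' \<and> (r \<in> A) \<noteq> (r' \<in> A)}"
  let ?U = "{u \<in> V. (u \<in> A) \<noteq> (v \<in> A)}"
  \<comment> \<open>A pair containing \<open>v\<close> is determined by its other row
    \<open>u\<close>; \<open>pr\<close> puts the two in increasing order.\<close>
  define pr where "pr = (\<lambda>u. if v < u then (v, u) else (u, v))"
  have inj: "inj_on pr ?U"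
    unfolding pr_def inj_on_def using assms by (auto split: if_splits)
  have D: "?D (insert v V) = pr ` ?U \<union> ?D V"
  proof (intro equalityI subsetI)
    fix x assume "x \<in> ?D (insert v V)"
    then obtain r r' where x: "x = (r, r')" "(r, r') \<in> ?D (insert v V)" by (cases x) auto
    consider "r = v" | "r' = v" "r \<noteq> v" | "r \<noteq> v" "r' \<noteq> v" by blast
    then show "x \<in> pr ` ?U \<union> ?D V"
    proof cases
      case 1
      then have "x = pr r'" "r' \<in> ?U" using x by (auto simp: pr_def)
      then show ?thesis by blast
    next
      case 2
      then have "x = pr r" "r \<in> ?U" using x by (auto simp: pr_def)
      then show ?thesis by blast
    qed (use x in auto)
  next
    have "u < v" if "u \<in> V" "\<not> v < u" for u
      using that assms by (metis not_less_iff_gr_or_eq)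
    then show "x \<in> ?D (insert v V)" if "x \<in> pr ` ?U \<union> ?D V" for x
      using that by (auto simp: pr_def split: if_splits)
  qed
  have "finite (?D V)"
    by (rule finite_subset[of _ "V \<times> V"]) (use assms in auto)
  moreover have "pr ` ?U \<inter> ?D V = {}"
    using assms by (auto simp: pr_def split: if_splits)
  ultimately have "column_weight p q t (insert v V) A =
      (\<Prod>(r, r')\<in>pr ` ?U. if (r' \<in> A) = t r r' then p else q) * column_weight p q t V A"
    unfolding column_weight_def D using assms by (subst prod.union_disjoint) auto
  also have "(\<Prod>(r, r')\<in>pr ` ?U. if (r' \<in> A) = t r r' then p else q) =
      (\<Prod>u\<in>?U. if v < u then (if (u \<in> A) = t v u then p else q)
              else (if (v \<in> A) = t u v then p else q))"
    by (subst prod.reindex[OF inj], intro prod.cong) (auto simp: pr_def)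
  finally show ?thesis .
qed

lemma column_weight_cong:
  assumes "A \<inter> V = A' \<inter> V"
  shows "column_weight p q t V A = column_weight p q t V A'"
proof -
  have "r \<in> A \<longleftrightarrow> r \<in> A'" if "r \<in> V" for r using assms that by blast
  then show ?thesis
    unfolding column_weight_def by (intro prod.cong) auto
qed

text \<open>At an extreme row \<open>v\<close> all pairs through \<open>v\<close> receive the same
  variable. If \<open>v\<close> belongs to the column, these pairs are formed with the rows outside
  \<open>A\<close>; if not, with the rows of \<open>A\<close>, and the variable is the other
  one.\<close>

lemma column_weight_insert_extreme:
  fixes V :: "'r::linorder set"
  assumes "finite V" "V \<noteq> {}" "one_sided t"
  obtains v b where "v \<in> V"
    and "\<And>A. A \<subseteq> V - {v} \<Longrightarrow> column_weight p q t V (insert v A) =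
           (if b then p else q) ^ (card (V - {v}) - card A) * column_weight p q t (V - {v}) A"
    and "\<And>A. A \<subseteq> V - {v} \<Longrightarrow> column_weight p q t V A =
           (if b then q else p) ^ card A * column_weight p q t (V - {v}) A"
proof -
  \<comment> \<open>If the upper row decides, the least row is the upper one of all its pairs; if
    the lower row decides, the greatest row is the lower one of all its pairs. In both cases
    \<open>t\<close> is constant on these pairs, and \<open>b\<close> says that their factor is
    \<open>p\<close> when \<open>v\<close> is in the column.\<close>
  obtain v b where v: "v \<in> V"
    and b: "\<And>u. u \<in> V - {v} \<Longrightarrow> if v < u then t v u = (\<not> b) else t u v = b"
  proof -
    from assms(3) consider T where "t = (\<lambda>r r'. r \<in> T)" | T where "t = (\<lambda>r r'. r' \<in> T)"
      unfolding one_sided_def by blast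
    then show thesis
    proof cases
      case 1
      show thesis
        by (rule that[of "Min V" "Min V \<notin> T"]) (use assms 1 in \<open>auto simp: order.strict_iff_order\<close>)
    next
      case 2
      show thesis
        by (rule that[of "Max V" "Max V \<in> T"]) (use assms 2 in \<open>auto simp: not_less[symmetric]\<close>)
    qed
  qed
  let ?W = "V - {v}"
  have V: "V = insert v ?W" and W: "finite ?W" "v \<notin> ?W" using v assms by auto
  show thesis
  proof (rule that[OF v])
    fix A assume A: "A \<subseteq> ?W"
    then have vA: "v \<notin> A" and finA: "finite A" using W finite_subset by auto
    have "column_weight p q t V (insert v A) =
        (\<Prod>u\<in>?W - A. if b then p else q) * column_weight p q t ?W (insert v A)"
    proof -
      have "{u \<in> ?W. (u \<in> insert v A) \<noteq> (v \<in> insert v A)} = ?W - A" using A vA by auto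
      moreover have "(if v < u then (if (u \<in> insert v A) = t v u then p else q)
              else (if (v \<in> insert v A) = t u v then p else q)) = (if b then p else q)" if "u \<in> ?W - A" for u
        using b[of u] that vA subsetD[OF A, of u] by (cases "v < u"; cases "u \<in> ?W"; auto)
      ultimately show ?thesis
        by (subst V, subst column_weight_insert[OF W]) (simp cong: prod.cong_simp)
    qed
    also have "column_weight p q t ?W (insert v A) = column_weight p q t ?W A"
      by (rule column_weight_cong) auto
    finally show "column_weight p q t V (insert v A) =
           (if b then p else q) ^ (card ?W - card A) * column_weight p q t ?W A"
      using A finA by (simp add: card_Diff_subset)
    have "column_weight p q t V A = (\<Prod>u\<in>A. if b then q else p) * column_weight p q t ?W A"
    proof -
      have "{u \<in> ?W. (u \<in> A) \<noteq> (v \<in> A)} = A" using A vA by auto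
      moreover have "(if v < u then (if (u \<in> A) = t v u then p else q)
              else (if (v \<in> A) = t u v then p else q)) = (if b then q else p)" if "u \<in> A" for u
        using b[of u] that vA subsetD[OF A, of u] by (cases "v < u"; cases "u \<in> ?W"; auto)
      ultimately show ?thesis
        by (subst V, subst column_weight_insert[OF W]) (simp cong: prod.cong_simp)
    qed
    then show "column_weight p q t V A = (if b then q else p) ^ card A * column_weight p q t ?W A"
      by simp
  qed
qed

text \<open>Induction on the number of rows: the \<open>k\<close>-subsets are split according to
  whether they contain the extreme row \<open>v\<close>, which gives the two terms of a Pascal
  recursion.\<close>

lemma sum_column_weight:
  fixes V :: "'r::linorder set"
  assumes "finite V" "one_sided t"
  shows "(\<Sum>A | A \<subseteq> V \<and> card A = k. column_weight p q t V A) = pqbin p q (card V) k"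
  using assms
proof (induction "card V" arbitrary: V k)
  case 0
  then have "V = {}" by simp
  then have set: "{A. A \<subseteq> V \<and> card A = k} = (if k = 0 then {{}} else {})"
    by auto
  show ?case
    unfolding set using \<open>V = {}\<close> by (cases k) (simp_all add: column_weight_def)
next
  case (Suc h)
  then have ne: "V \<noteq> {}" by auto
  obtain v b where v: "v \<in> V"
    and w1: "\<And>A. A \<subseteq> V - {v} \<Longrightarrow> column_weight p q t V (insert v A) =
           (if b then p else q) ^ (card (V - {v}) - card A) * column_weight p q t (V - {v}) A"
    and w2: "\<And>A. A \<subseteq> V - {v} \<Longrightarrow> column_weight p q t V A =
           (if b then q else p) ^ card A * column_weight p q t (V - {v}) A"
    using column_weight_insert_extreme[OF Suc.prems(1) ne Suc.prems(2), of p q] by metis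
  let ?W = "V - {v}"
  have cW: "card ?W = h" using Suc v by simp
  have IH: "(\<Sum>A | A \<subseteq> ?W \<and> card A = k. column_weight p q t ?W A) = pqbin p q h k" for k
    using Suc.hyps(1)[of ?W k] cW Suc.prems by auto
  have fin: "finite {A. A \<subseteq> ?W \<and> card A = k}" for k
    using Suc.prems by simp
  have finA: "finite A" if "A \<subseteq> ?W" for A
    using Suc.prems that finite_subset by blast
  have notin: "(\<Sum>A | A \<subseteq> ?W \<and> card A = k. column_weight p q t V A) =
      (if b then q else p) ^ k * pqbin p q h k" for k
    unfolding IH[symmetric] sum_distrib_left by (rule sum.cong) (use w2 in auto)
  show ?case
  proof (cases k)
    case 0
    have "{A. A \<subseteq> V \<and> card A = k} = {A. A \<subseteq> ?W \<and> card A = k}"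
      using 0 Suc.prems by (auto dest: finite_subset)
    then show ?thesis using notin[of 0] 0 by simp
  next
    case (Suc j)
    have split: "{A. A \<subseteq> V \<and> card A = k} =
        insert v ` {A. A \<subseteq> ?W \<and> card A = j} \<union> {A. A \<subseteq> ?W \<and> card A = k}" (is "?L = ?R")
    proof (intro equalityI subsetI)
      fix A assume A: "A \<in> ?L"
      show "A \<in> ?R"
      proof (cases "v \<in> A")
        case True
        then have "A = insert v (A - {v})" "A - {v} \<subseteq> ?W" "card (A - {v}) = j"
          using A Suc by auto
        then show ?thesis by blast
      qed (use A in auto)
    next
      fix A assume "A \<in> ?R"
      then show "A \<in> ?L" using v Suc finA by (auto simp: card_insert_if)
    qed
    have "(\<Sum>A | A \<subseteq> V \<and> card A = k. column_weight p q t V A) =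
        (\<Sum>A | A \<subseteq> ?W \<and> card A = j. column_weight p q t V (insert v A)) +
        (\<Sum>A | A \<subseteq> ?W \<and> card A = k. column_weight p q t V A)"
    proof -
      have "inj_on (insert v) {A. A \<subseteq> ?W \<and> card A = j}"
        by (auto simp: inj_on_def insert_ident)
      then show ?thesis
        unfolding split
        by (subst sum.union_disjoint[OF finite_imageI[OF fin] fin]) (auto simp: sum.reindex)
    qed
    also have "(\<Sum>A | A \<subseteq> ?W \<and> card A = j. column_weight p q t V (insert v A)) =
        (if b then p else q) ^ (h - j) * pqbin p q h j"
      unfolding IH[symmetric] sum_distrib_left by (rule sum.cong) (use w1 cW in auto)
    also note notin
    \<comment> \<open>For \<open>b\<close> true this is the defining recursion of
      \<open>pqbin\<close>, for \<open>b\<close> false it is \<open>pqbin_Pascal\<close>.\<close>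
    finally show ?thesis
      using \<open>Suc h = card V\<close>[symmetric] Suc pqbin_Pascal[of p q h j]
      by (cases b) (simp_all del: power_Suc)
  qed
qed

section \<open>Peeling off columns\<close>

text \<open>\<open>I c\<close> stands for the rows met by column \<open>c\<close>, and
  \<open>R\<close> for the rows that carry a 1-cell. Keeping \<open>R\<close> separate from
  \<open>I\<close> allows occupied rows to be deleted without changing the shape.\<close>

definition placements ::
    "('c \<Rightarrow> nat) \<Rightarrow> ('c \<Rightarrow> 'r set) \<Rightarrow> 'c set \<Rightarrow> 'r set \<Rightarrow> ('r \<Rightarrow> 'c) set" where
  "placements s I C R =
     {g \<in> R \<rightarrow>\<^sub>E C. (\<forall>r\<in>R. r \<in> I (g r)) \<and> (\<forall>c\<in>C. card {r \<in> R. g r = c} = s c)}"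

text \<open>The last two conditions say that the two remaining corners of the rectangle lie in the
  polyomino; by convexity this is equivalent to containing the whole rectangle.\<close>

definition chain_pairs ::
    "('c \<Rightarrow> 'r::linorder set) \<Rightarrow> 'r set \<Rightarrow> ('r \<Rightarrow> 'c) \<Rightarrow> ('r \<times> 'r) set" where
  "chain_pairs I R g =
     {(r, r'). r \<in> R \<and> r' \<in> R \<and> r < r' \<and> g r \<noteq> g r' \<and> r \<in> I (g r') \<and> r' \<in> I (g r)}"

text \<open>The test \<open>g r' < g r\<close> recognises an NE chain, so NE chains get
  \<open>p\<close> exactly when \<open>t\<close> holds and SE chains exactly when it fails.\<close>

definition weight ::
    "'a \<Rightarrow> 'a \<Rightarrow> ('r::linorder \<Rightarrow> 'r \<Rightarrow> bool) \<Rightarrow> ('c::linorder \<Rightarrow> 'r set) \<Rightarrow> 'r set \<Rightarrow> ('r \<Rightarrow> 'c) \<Rightarrow>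
     'a::comm_semiring_1" where
  "weight p q t I R g =
     (\<Prod>(r, r')\<in>chain_pairs I R g. if (g r' < g r) = t r r' then p else q)"

text \<open>A placement is the same as its fibre \<open>A\<close> over \<open>c\<close> together
  with its restriction to the other rows.\<close>

lemma sum_placements_remove:
  assumes "finite C" "c \<in> C" "finite R"
  shows "(\<Sum>g\<in>placements s I C R. h g) =
     (\<Sum>A | A \<subseteq> R \<inter> I c \<and> card A = s c.
        \<Sum>g\<in>placements s I (C - {c}) (R - A). h (\<lambda>r. if r \<in> A then c else g r))"
proof -
  let ?As = "{A. A \<subseteq> R \<inter> I c \<and> card A = s c}"
  have finA: "finite ?As" using assms by simp
  have finP: "finite (placements s I (C - {c}) (R - A))" for A
    by (rule finite_subset[of _ "(R - A) \<rightarrow>\<^sub>E (C - {c})"])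
       (use assms in \<open>auto simp: placements_def intro!: finite_PiE\<close>)
  let ?i = "\<lambda>(A, g) r. if r \<in> A then c else g r"
  let ?fib = "\<lambda>g. {r \<in> R. g r = c}"
  have "(\<Sum>g\<in>placements s I C R. h g) =
      (\<Sum>x\<in>Sigma ?As (\<lambda>A. placements s I (C - {c}) (R - A)). h (?i x))"
  proof (rule sum.reindex_bij_witness[where i = ?i and j = "\<lambda>g. (?fib g, restrict g (R - ?fib g))"])
    fix g assume g: "g \<in> placements s I C R"
    show inv: "?i (?fib g, restrict g (R - ?fib g)) = g"
    proof
      fix r
      show "?i (?fib g, restrict g (R - ?fib g)) r = g r"
        using g by (cases "r \<in> R") (auto simp: placements_def PiE_iff extensional_def)
    qed
    show "h (?i (?fib g, restrict g (R - ?fib g))) = h g"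
      by (simp only: inv)
    have "{r \<in> R - ?fib g. restrict g (R - ?fib g) r = c'} = {r \<in> R. g r = c'}" if "c' \<noteq> c" for c'
      using that by auto
    then show "(?fib g, restrict g (R - ?fib g)) \<in> Sigma ?As (\<lambda>A. placements s I (C - {c}) (R - A))"
      using g assms by (auto simp: placements_def PiE_iff)
  next
    fix x assume "x \<in> Sigma ?As (\<lambda>A. placements s I (C - {c}) (R - A))"
    then obtain A g where x: "x = (A, g)" "A \<subseteq> R \<inter> I c" "card A = s c"
      "g \<in> placements s I (C - {c}) (R - A)" by auto
    have g: "g r \<in> C" "g r \<noteq> c" "r \<in> I (g r)" if "r \<in> R" "r \<notin> A" for r
      using x(4) that by (auto simp: placements_def)
    \<comment> \<open>Extensionality of \<open>g\<close> is what lets the restriction to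
      \<open>R - A\<close> recover it exactly.\<close>
    have und: "g r = undefined" if "r \<in> A \<or> r \<notin> R" for r
      using x(4) that by (auto simp: placements_def PiE_iff extensional_def)
    have fib: "?fib (?i x) = A" using x(1,2) g by auto
    moreover have "restrict (?i x) (R - A) = g"
      using x(1,2) und by (auto simp: fun_eq_iff)
    ultimately show "(?fib (?i x), restrict (?i x) (R - ?fib (?i x))) = x"
      using x(1) by simp
    have "{r \<in> R. ?i x r = c'} = {r \<in> R - A. g r = c'}" if "c' \<noteq> c" for c'
      using that x(1) by auto
    moreover have "card {r \<in> R - A. g r = c'} = s c'" if "c' \<in> C" "c' \<noteq> c" for c'
      using x(4) that by (auto simp: placements_def)
    ultimately have "card {r \<in> R. ?i x r = c'} = s c'" if "c' \<in> C" for c'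
      using that fib x(3) by (cases "c' = c") auto
    moreover have "?i x \<in> R \<rightarrow>\<^sub>E C"
      using x(1,2) g(1) und assms(2) by (auto simp: PiE_iff extensional_def)
    moreover have "r \<in> I (?i x r)" if "r \<in> R" for r
      using that x(1,2) g(3) by auto
    ultimately show "?i x \<in> placements s I C R"
      by (simp add: placements_def)
  qed
  also have "\<dots> = (\<Sum>A\<in>?As. \<Sum>g\<in>placements s I (C - {c}) (R - A). h (?i (A, g)))"
    using finA finP by (subst sum.Sigma) (auto simp: split_beta)
  finally show ?thesis by simp
qed

text \<open>
  Every row of \<open>R \<inter> I c - A\<close> is filled by a column beyond \<open>c\<close>, on the same side of \<open>c\<close>, which
  meets all rows of \<open>I c\<close>; so the chains using column \<open>c\<close> are determined by \<open>A\<close> alone.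
\<close>
lemma weight_remove:
  fixes C :: "'c::linorder set" and R :: "'r::linorder set"
  assumes "finite R" "A \<subseteq> R \<inter> I c" "g \<in> placements s I (C - {c}) (R - A)"
    and sub: "\<And>c'. c' \<in> C \<Longrightarrow> I c \<subseteq> I c'"
    and side: "\<And>c'. c' \<in> C - {c} \<Longrightarrow> (c' < c) = b"
  shows "weight p q t I R (\<lambda>r. if r \<in> A then c else g r) =
     column_weight p q (\<lambda>r r'. t r r' \<noteq> b) (R \<inter> I c) A * weight p q t I (R - A) g"
proof -
  let ?g = "\<lambda>r. if r \<in> A then c else g r"
  let ?V = "R \<inter> I c"
  let ?D = "{(r, r'). r \<in> ?V \<and> r' \<in> ?V \<and> r < r' \<and> (r \<in> A) \<noteq> (r' \<in> A)}"
  have g: "g r \<in> C - {c}" "I c \<subseteq> I (g r)" "g r \<noteq> c" "g r < c \<longleftrightarrow> b" "c < g r \<longleftrightarrow> \<not> b"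
    if "r \<in> R" "r \<notin> A" for r
  proof -
    show *: "g r \<in> C - {c}" using assms(3) that by (auto simp: placements_def)
    then show "I c \<subseteq> I (g r)" "g r \<noteq> c" "g r < c \<longleftrightarrow> b" using sub side by auto
    then show "c < g r \<longleftrightarrow> \<not> b" by auto
  qed
  \<comment> \<open>Two rows of \<open>A\<close> share column \<open>c\<close> and form no chain;
    the remaining pairs have one row in \<open>A\<close> or none.\<close>
  have D: "chain_pairs I R ?g = ?D \<union> chain_pairs I (R - A) g"
  proof (intro equalityI subsetI)
    fix x assume "x \<in> chain_pairs I R ?g"
    then show "x \<in> ?D \<union> chain_pairs I (R - A) g"
      using assms(2) by (auto simp: chain_pairs_def split: if_splits)
  next
    fix x assume "x \<in> ?D \<union> chain_pairs I (R - A) g"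
    then consider r r' where "x = (r, r')" "(r, r') \<in> ?D" "r \<in> A" "r' \<notin> A"
      | r r' where "x = (r, r')" "(r, r') \<in> ?D" "r \<notin> A" "r' \<in> A"
      | r r' where "x = (r, r')" "(r, r') \<in> chain_pairs I (R - A) g"
      by (cases x) auto
    then show "x \<in> chain_pairs I R ?g"
    proof cases
      case (1 r r')
      then show ?thesis using g(2,3)[of r'] by (auto simp: chain_pairs_def)
    next
      case (2 r r')
      then show ?thesis using g(2,3)[of r] by (auto simp: chain_pairs_def)
    next
      case (3 r r')
      then show ?thesis by (auto simp: chain_pairs_def)
    qed
  qed
  have "?D \<subseteq> R \<times> R" "chain_pairs I (R - A) g \<subseteq> R \<times> R" by (auto simp: chain_pairs_def)
  then have fin: "finite ?D" "finite (chain_pairs I (R - A) g)"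
    using assms(1) finite_subset by blast+
  have "?D \<inter> chain_pairs I (R - A) g = {}"
    by (auto simp: chain_pairs_def)
  then have "weight p q t I R ?g =
      (\<Prod>(r, r')\<in>?D. if (?g r' < ?g r) = t r r' then p else q) *
      (\<Prod>(r, r')\<in>chain_pairs I (R - A) g. if (?g r' < ?g r) = t r r' then p else q)"
    unfolding weight_def D using fin by (subst prod.union_disjoint) auto
  \<comment> \<open>\<open>column_weight\<close> is normalised to a column left of all others. If
    \<open>b\<close> holds, column \<open>c\<close> lies to the right instead, and comparing
    \<open>t\<close> with \<open>b\<close> compensates for the exchange of NE and SE.\<close>
  also have "(\<Prod>(r, r')\<in>?D. if (?g r' < ?g r) = t r r' then p else q) =
      column_weight p q (\<lambda>r r'. t r r' \<noteq> b) ?V A"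
    unfolding column_weight_def
  proof (rule prod.cong[OF refl], clarify)
    fix r r' assume "r \<in> R" "r' \<in> R" "(r \<in> A) \<noteq> (r' \<in> A)"
    then show "(if (?g r' < ?g r) = t r r' then p else q) =
        (if (r' \<in> A) = (t r r' \<noteq> b) then p else q)"
      using g(4,5)[of r] g(4,5)[of r'] by (cases "r \<in> A"; cases b) auto
  qed
  also have "(\<Prod>(r, r')\<in>chain_pairs I (R - A) g. if (?g r' < ?g r) = t r r' then p else q) =
      weight p q t I (R - A) g"
    unfolding weight_def by (rule prod.cong) (auto simp: chain_pairs_def)
  finally show ?thesis .
qed

text \<open>The smaller of the two end columns equals the intersection of both, and
  \<open>conv\<close> puts this intersection into every column between them. \<open>b\<close>
  records at which end it was found.\<close>

lemma extreme_column:
  fixes C :: "'c::linorder set"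
  assumes "finite C" "C \<noteq> {}"
    and comp: "\<And>c c'. c \<in> C \<Longrightarrow> c' \<in> C \<Longrightarrow> I c \<subseteq> I c' \<or> I c' \<subseteq> I c"
    and conv: "\<And>c k c'. \<lbrakk>c \<in> C; k \<in> C; c' \<in> C; c \<le> k; k \<le> c'\<rbrakk> \<Longrightarrow> I c \<inter> I c' \<subseteq> I k"
  shows "\<exists>c\<in>C. \<exists>b. (\<forall>c'\<in>C. I c \<subseteq> I c') \<and> (\<forall>c'\<in>C - {c}. (c' < c) = b)"
proof -
  have M: "Min C \<in> C" "Max C \<in> C" using assms by auto
  have I: "I (Min C) \<inter> I (Max C) \<subseteq> I k" if "k \<in> C" for k
    using conv[of "Min C" k "Max C"] M assms(1) that by simp
  from comp[OF M] show ?thesis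
  proof
    assume *: "I (Min C) \<subseteq> I (Max C)"
    then have "I (Min C) \<subseteq> I k" if "k \<in> C" for k
      using I[OF that] by blast
    then show ?thesis
      using M(1) assms(1) by (intro bexI[of _ "Min C"] exI[of _ False]) (auto simp: not_less)
  next
    assume *: "I (Max C) \<subseteq> I (Min C)"
    then have "I (Max C) \<subseteq> I k" if "k \<in> C" for k
      using I[OF that] by blast
    then show ?thesis
      using M(2) assms(1) by (intro bexI[of _ "Max C"] exI[of _ True]) (auto simp: order.strict_iff_order)
  qed
qed

text \<open>The row set varies along with \<open>t\<close>, since peeling leaves
  \<open>R - A\<close> with \<open>A\<close> running over many subsets. Only cardinalities are
  required to agree, and they stay in agreement: \<open>A\<close> lies in \<open>I c\<close> and so
  in every \<open>I c'\<close>, hence each count drops by exactly \<open>s c\<close>.\<close>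

theorem sum_weight_eq:
  fixes C :: "'c::linorder set" and R :: "'r::linorder set"
  assumes "finite C" "finite R" "finite R'" "one_sided t" "one_sided t'"
    and "\<And>c c'. c \<in> C \<Longrightarrow> c' \<in> C \<Longrightarrow> I c \<subseteq> I c' \<or> I c' \<subseteq> I c"
    and "\<And>c k c'. \<lbrakk>c \<in> C; k \<in> C; c' \<in> C; c \<le> k; k \<le> c'\<rbrakk> \<Longrightarrow> I c \<inter> I c' \<subseteq> I k"
    and "card R = card R'" "\<And>c. c \<in> C \<Longrightarrow> card (R \<inter> I c) = card (R' \<inter> I c)"
  shows "(\<Sum>g\<in>placements s I C R. weight p q t I R g) =
         (\<Sum>g\<in>placements s I C R'. weight p q t' I R' g)"
  using assms
proof (induction "card C" arbitrary: C R R' t t')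
  case 0
  then have C: "C = {}" by simp
  \<comment> \<open>Without columns a placement exists only for the empty row set, and then it has
    weight 1.\<close>
  show ?case
  proof (cases "R = {}")
    case True
    then have "R' = {}" using 0 by simp
    then show ?thesis using True by (simp add: weight_def chain_pairs_def)
  next
    case False
    then have "R' \<noteq> {}" using 0 by auto
    then have "placements s I C R = {}" "placements s I C R' = {}"
      using False unfolding C placements_def by (auto simp: PiE_eq_empty_iff)
    then show ?thesis by simp
  qed
next
  case (Suc n)
  then have "C \<noteq> {}" by auto
  with Suc.prems have "\<exists>c\<in>C. \<exists>b. (\<forall>c'\<in>C. I c \<subseteq> I c') \<and> (\<forall>c'\<in>C - {c}. (c' < c) = b)"
    by (intro extreme_column)
  then obtain c b where c: "c \<in> C" and sub: "\<And>c'. c' \<in> C \<Longrightarrow> I c \<subseteq> I c'"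
    and side: "\<And>c'. c' \<in> C - {c} \<Longrightarrow> (c' < c) = b"
    by metis
  let ?F = "\<lambda>t R. \<Sum>g\<in>placements s I (C - {c}) R. weight p q t I R g"
  let ?As = "\<lambda>R. {A. A \<subseteq> R \<inter> I c \<and> card A = s c}"
  have remove: "(\<Sum>g\<in>placements s I C R. weight p q t I R g) =
      (\<Sum>A\<in>?As R. column_weight p q (\<lambda>r r'. t r r' \<noteq> b) (R \<inter> I c) A * ?F t (R - A))"
    if "finite R" for R t
    unfolding sum_placements_remove[OF Suc.prems(1) c that] sum_distrib_left
    by (intro sum.cong refl weight_remove[where C = C]) (use that sub side in auto)
  have os: "one_sided (\<lambda>r r'. t r r' \<noteq> b)" if "one_sided t" for t :: "'r \<Rightarrow> 'r \<Rightarrow> bool"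
    using that one_sided_not[of t] by (cases b) auto
  have card_eq: "card (R \<inter> I c) = card (R' \<inter> I c)" using Suc.prems c by blast
  have cardD: "card (X - A) = card X - s c" if "finite R" "A \<in> ?As R" "A \<subseteq> X" for A R and X :: "'r set"
    using that by (subst card_Diff_subset) (auto dest: finite_subset)
  \<comment> \<open>\<open>X\<close> and \<open>Y\<close> may coincide: the same fact compares
    different subsets of one row set and also the two row sets with each other.\<close>
  have IH: "?F u (X - A) = ?F v (Y - B)"
    if X: "X \<in> {R, R'}" "Y \<in> {R, R'}" and u: "one_sided u" "one_sided v"
      and A: "A \<in> ?As X" "B \<in> ?As Y" for u v X Y A B
  proof (rule Suc.hyps(1))
    have fin: "finite X" "finite Y" using X Suc.prems by auto
    have cc: "card X = card Y" "\<And>c. c \<in> C \<Longrightarrow> card (X \<inter> I c) = card (Y \<inter> I c)"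
      using X Suc.prems by auto
    show "card (X - A) = card (Y - B)"
      using cardD[OF fin(1) A(1), of X] cardD[OF fin(2) A(2), of Y] A cc by auto
    show "card ((X - A) \<inter> I c') = card ((Y - B) \<inter> I c')" if "c' \<in> C - {c}" for c'
    proof -
      have "A \<subseteq> X \<inter> I c'" "B \<subseteq> Y \<inter> I c'" using A sub[of c'] that by auto
      moreover have "(X - A) \<inter> I c' = X \<inter> I c' - A" "(Y - B) \<inter> I c' = Y \<inter> I c' - B" by auto
      ultimately show ?thesis
        using cardD[OF fin(1) A(1), of "X \<inter> I c'"] cardD[OF fin(2) A(2), of "Y \<inter> I c'"] cc(2)[of c'] that by simp
    qed
  qed (use X u A Suc.hyps(2) c Suc.prems in auto)
  show ?case
  \<comment> \<open>The set is empty when \<open>s c\<close> exceeds the number of available rows,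
    which is the same for \<open>R\<close> and \<open>R'\<close>; then both sums vanish.\<close>
  proof (cases "?As R' = {}")
    case True
    have "?As R = {}"
    proof (rule ccontr)
      assume "?As R \<noteq> {}"
      then obtain A where "A \<subseteq> R \<inter> I c" "card A = s c" by blast
      then have "s c \<le> card (R \<inter> I c)" using Suc.prems(2) card_mono[of "R \<inter> I c" A] by simp
      then have "s c \<le> card (R' \<inter> I c)" using card_eq by simp
      then obtain A where "A \<subseteq> R' \<inter> I c" "card A = s c"
        using obtain_subset_with_card_n by metis
      then show False using True by blast
    qed
    then show ?thesis using True Suc.prems by (simp only: remove sum.empty)
  next
    case False
    then obtain B where B: "B \<in> ?As R'" by blast
    \<comment> \<open>The inner sum is the same for all \<open>A\<close>, so it is replaced by its
      value at the reference subset \<open>B\<close> and factored out. What remains is a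
      single-column sum, a \<open>p,q\<close>-binomial coefficient that depends on \<open>X\<close>
      only through its cardinality in \<open>I c\<close>.\<close>
    have "(\<Sum>g\<in>placements s I C X. weight p q u I X g) = pqbin p q (card (R \<inter> I c)) (s c) * ?F t' (R' - B)"
      if "X \<in> {R, R'}" "one_sided u" for X u
    proof -
      have fin: "finite X" and cX: "card (X \<inter> I c) = card (R \<inter> I c)"
        using that Suc.prems(2,3) card_eq by auto
      have "(\<Sum>g\<in>placements s I C X. weight p q u I X g) =
          (\<Sum>A\<in>?As X. column_weight p q (\<lambda>r r'. u r r' \<noteq> b) (X \<inter> I c) A * ?F t' (R' - B))"
        unfolding remove[OF fin]
        by (intro sum.cong refl arg_cong2[where f = "(*)"] IH) (use that B Suc.prems in auto)
      also have "\<dots> = pqbin p q (card (X \<inter> I c)) (s c) * ?F t' (R' - B)"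
        unfolding sum_distrib_right[symmetric]
        by (subst sum_column_weight) (use fin os that in auto)
      finally show ?thesis unfolding cX .
    qed
    from this[of R t] this[of R' t'] show ?thesis using Suc.prems by simp
  qed
qed

section \<open>Fillings of moon polyominoes\<close>

lemma bij_betw_sorted_list_of_set_nth:
  fixes X :: "'b::linorder set"
  assumes "finite X"
  shows "bij_betw (\<lambda>i. sorted_list_of_set X ! (i - 1)) {1..card X} X"
proof -
  have "bij_betw (\<lambda>i. i - 1) {1..card X} {..<card X}"
    by (rule bij_betw_byWitness[where f' = Suc]) auto
  moreover have "bij_betw ((!) (sorted_list_of_set X)) {..<card X} X"
    using assms by (intro bij_betw_nth) auto
  ultimately show ?thesis
    using bij_betw_trans by (fastforce simp: comp_def)
qed

lemma one_cells_subset: "one_cells P f \<subseteq> P"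
  by (auto simp: one_cells_def)

text \<open>Row and column sums are transported from the labels 1, 2, ... to the integer coordinates
  by inverting the sorted enumeration.\<close>

lemma fillings_with_relabel:
  assumes "finite P" and e: "\<forall>i\<in>{1..num_rows P}. e i \<in> {0, 1}"
  obtains e' s' where "\<forall>r\<in>fst ` P. e' r \<in> {0, 1}"
    "fillings_with P e s = {f \<in> P \<rightarrow>\<^sub>E {0, 1}.
       (\<forall>r\<in>fst ` P. card {c. (r, c) \<in> one_cells P f} = e' r) \<and>
       (\<forall>c\<in>snd ` P. card {r. (r, c) \<in> one_cells P f} = s' c)}"
proof -
  define \<rho> where "\<rho> = (\<lambda>i. sorted_list_of_set (fst ` P) ! (i - 1))"
  define \<kappa> where "\<kappa> = (\<lambda>j. sorted_list_of_set (snd ` P) ! (j - 1))"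
  let ?N = "{1..num_rows P}" and ?M = "{1..num_cols P}"
  have \<rho>: "bij_betw \<rho> ?N (fst ` P)" and \<kappa>: "bij_betw \<kappa> ?M (snd ` P)"
    unfolding \<rho>_def \<kappa>_def num_rows_def num_cols_def
    using assms(1) by (auto intro!: bij_betw_sorted_list_of_set_nth simp del: One_nat_def)
  define e' where "e' = (\<lambda>r. e (inv_into ?N \<rho> r))"
  define s' where "s' = (\<lambda>c. s (inv_into ?M \<kappa> c))"
  have e'_eq: "e' (\<rho> i) = e i" if "i \<in> ?N" for i
    using \<rho> that unfolding e'_def by (simp add: bij_betw_inv_into_left)
  have s'_eq: "s' (\<kappa> j) = s j" if "j \<in> ?M" for j
    using \<kappa> that unfolding s'_def by (simp add: bij_betw_inv_into_left)
  have rowc: "card (one_cells P f \<inter> row P i) = card {c. (\<rho> i, c) \<in> one_cells P f}" for f i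
  proof -
    have "one_cells P f \<inter> row P i = Pair (\<rho> i) ` {c. (\<rho> i, c) \<in> one_cells P f}"
      by (auto simp: row_def \<rho>_def one_cells_def)
    then show ?thesis by (simp add: card_image inj_on_def)
  qed
  have colc: "card (one_cells P f \<inter> col P j) = card {r. (r, \<kappa> j) \<in> one_cells P f}" for f j
  proof -
    have "one_cells P f \<inter> col P j = (\<lambda>r. (r, \<kappa> j)) ` {r. (r, \<kappa> j) \<in> one_cells P f}"
      by (auto simp: col_def \<kappa>_def one_cells_def)
    then show ?thesis by (simp add: card_image inj_on_def)
  qed
  have imgs: "fst ` P = \<rho> ` ?N" "snd ` P = \<kappa> ` ?M"
    using \<rho> \<kappa> by (auto simp: bij_betw_def)
  show thesis
  proof (rule that[of e' s'])
    show "\<forall>r\<in>fst ` P. e' r \<in> {0, 1}"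
      unfolding imgs(1) using e e'_eq by simp
    \<comment> \<open>The bound of one 1-cell per row is absorbed by the prescribed row sums, which
      are 0 or 1.\<close>
    have "card (one_cells P f \<inter> row P i) \<le> 1"
      if "\<forall>i\<in>?N. card (one_cells P f \<inter> row P i) = e i" "i \<in> ?N" for f i
      using that e by fastforce
    then have "fillings_with P e s = {f \<in> P \<rightarrow>\<^sub>E {0, 1}.
        (\<forall>i\<in>?N. card (one_cells P f \<inter> row P i) = e i) \<and>
        (\<forall>j\<in>?M. card (one_cells P f \<inter> col P j) = s j)}"
      unfolding fillings_with_def fillings_def by blast
    then show "fillings_with P e s = {f \<in> P \<rightarrow>\<^sub>E {0, 1}.
       (\<forall>r\<in>fst ` P. card {c. (r, c) \<in> one_cells P f} = e' r) \<and>
       (\<forall>c\<in>snd ` P. card {r. (r, c) \<in> one_cells P f} = s' c)}"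
      unfolding imgs ball_simps rowc colc by (simp add: e'_eq s'_eq)
  qed
qed

section \<open>Placements as fillings\<close>

definition filling_of :: "cell set \<Rightarrow> int set \<Rightarrow> (int \<Rightarrow> int) \<Rightarrow> cell \<Rightarrow> nat" where
  "filling_of P R g = (\<lambda>x\<in>P. if fst x \<in> R \<and> g (fst x) = snd x then 1 else 0)"

lemma one_cells_filling_of:
  assumes "\<And>r. r \<in> R \<Longrightarrow> (r, g r) \<in> P"
  shows "one_cells P (filling_of P R g) = (\<lambda>r. (r, g r)) ` R"
  using assms by (auto simp: one_cells_def filling_of_def split: if_splits)

lemma filling_eqI:
  assumes "f \<in> P \<rightarrow>\<^sub>E {0, 1}" "f' \<in> P \<rightarrow>\<^sub>E {0, 1}" "one_cells P f = one_cells P f'"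
  shows "f = f'"
proof (rule PiE_ext[OF assms(1,2)])
  fix x assume x: "x \<in> P"
  then have "f x \<in> {0, 1}" "f' x \<in> {0, 1}" using assms(1,2) by blast+
  moreover have "f x = 1 \<longleftrightarrow> f' x = 1" using assms(3) x by (auto simp: one_cells_def)
  ultimately show "f x = f' x" by auto
qed

lemma filling_of_in: "filling_of P R g \<in> P \<rightarrow>\<^sub>E {0, 1}"
  by (auto simp: filling_of_def)

lemma bij_betw_filling_of:
  assumes P: "finite P" and e: "\<forall>r\<in>fst ` P. e r \<in> {0, 1}"
  shows "bij_betw (filling_of P {r \<in> fst ` P. e r = 1})
     (placements s (\<lambda>c. {r. (r, c) \<in> P}) (snd ` P) {r \<in> fst ` P. e r = 1})
     {f \<in> P \<rightarrow>\<^sub>E {0, 1}.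
        (\<forall>r\<in>fst ` P. card {c. (r, c) \<in> one_cells P f} = e r) \<and>
        (\<forall>c\<in>snd ` P. card {r. (r, c) \<in> one_cells P f} = s c)}"
    (is "bij_betw (filling_of P ?R) ?G ?F")
proof -
  have one: "one_cells P (filling_of P ?R g) = (\<lambda>r. (r, g r)) ` ?R" if "g \<in> ?G" for g
    using that by (intro one_cells_filling_of) (auto simp: placements_def)
  have mem: "filling_of P ?R g \<in> ?F" if g: "g \<in> ?G" for g
  proof -
    have "{c. (r, c) \<in> (\<lambda>r. (r, g r)) ` ?R} = (if e r = 1 then {g r} else {})" if "r \<in> fst ` P" for r
      using that by auto
    moreover have "{r. (r, c) \<in> (\<lambda>r. (r, g r)) ` ?R} = {r \<in> ?R. g r = c}" for c
      by auto
    moreover have "card (if e r = 1 then {g r} else {}) = e r" if "r \<in> fst ` P" for r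
      using e that by auto
    ultimately show ?thesis
      unfolding mem_Collect_eq one[OF g]
      using g filling_of_in[of P ?R g] by (simp add: placements_def)
  qed
  show ?thesis
  proof (rule bij_betw_imageI)
    show "inj_on (filling_of P ?R) ?G"
    proof (rule inj_onI)
      fix g g' assume g: "g \<in> ?G" "g' \<in> ?G" and eq: "filling_of P ?R g = filling_of P ?R g'"
      have "(\<lambda>r. (r, g r)) ` ?R = (\<lambda>r. (r, g' r)) ` ?R"
        using one[OF g(1)] one[OF g(2)] eq by simp
      then have "g r = g' r" if "r \<in> ?R" for r using that by blast
      moreover have "g \<in> ?R \<rightarrow>\<^sub>E snd ` P" "g' \<in> ?R \<rightarrow>\<^sub>E snd ` P"
        using g by (auto simp: placements_def)
      ultimately show "g = g'" by (rule PiE_ext[rotated 2])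
    qed
    show "filling_of P ?R ` ?G = ?F"
    proof (intro equalityI subsetI)
      fix f assume f: "f \<in> ?F"
      let ?O = "one_cells P f"
      have ex: "\<exists>c. {c. (r, c) \<in> ?O} = {c}" if "r \<in> ?R" for r
        using f that by (auto simp: card_1_singleton_iff)
      \<comment> \<open>Each row of \<open>?R\<close> has exactly one 1-cell, whose column is the
        value of the placement sought.\<close>
      define g where "g = (\<lambda>r\<in>?R. THE c. (r, c) \<in> ?O)"
      have g: "{c. (r, c) \<in> ?O} = {g r}" if r: "r \<in> ?R" for r
      proof -
        obtain c where "{c. (r, c) \<in> ?O} = {c}" using ex[OF r] by blast
        moreover from this have "(THE c. (r, c) \<in> ?O) = c" by (intro the_equality) auto
        ultimately show ?thesis using r by (simp add: g_def)
      qed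
      have emp: "(r, c) \<notin> ?O" if "r \<notin> ?R" for r c
      proof
        assume rc: "(r, c) \<in> ?O"
        then have "r \<in> fst ` P" using one_cells_subset by force
        \<comment> \<open>Finiteness excludes the convention that infinite sets have cardinality
          0.\<close>
        moreover have "finite {c. (r, c) \<in> ?O}"
          by (rule finite_subset[of _ "snd ` P"]) (use P one_cells_subset in force)+
        ultimately have "card {c. (r, c) \<in> ?O} \<noteq> 0" using rc by auto
        moreover have "card {c. (r, c) \<in> ?O} = e r" using f \<open>r \<in> fst ` P\<close> by blast
        ultimately have "e r \<noteq> 0" by simp
        then show False using that e \<open>r \<in> fst ` P\<close> by auto
      qed
      have O: "?O = (\<lambda>r. (r, g r)) ` ?R"
      proof (intro equalityI subrelI)
        fix r c assume rc: "(r, c) \<in> ?O"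
        then have r: "r \<in> ?R" using emp by blast
        moreover have "c = g r" using g[OF r] rc by blast
        ultimately show "(r, c) \<in> (\<lambda>r. (r, g r)) ` ?R" by blast
      qed (use g in blast)
      have inP: "(r, g r) \<in> P" if "r \<in> ?R" for r
        using O that one_cells_subset[of P f] by auto
      have "g \<in> ?G"
      proof -
        have "{r. (r, c) \<in> ?O} = {r \<in> ?R. g r = c}" for c using O by auto
        then have "\<forall>c\<in>snd ` P. card {r \<in> ?R. g r = c} = s c" using f by simp
        moreover have "g \<in> ?R \<rightarrow>\<^sub>E snd ` P"
        proof (rule PiE_I)
          show "g r \<in> snd ` P" if "r \<in> ?R" for r using inP[OF that] by force
        qed (auto simp: g_def)
        ultimately show ?thesis using inP by (simp add: placements_def)
      qed
      moreover have "filling_of P ?R g = f"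
      proof (rule filling_eqI[OF filling_of_in])
        show "f \<in> P \<rightarrow>\<^sub>E {0, 1}" using f by blast
        show "one_cells P (filling_of P ?R g) = ?O"
          by (rule trans[OF one[OF \<open>g \<in> ?G\<close>] O[symmetric]])
      qed
      ultimately show "f \<in> filling_of P ?R ` ?G" by blast
    next
      fix f assume "f \<in> filling_of P ?R ` ?G"
      then obtain g where "g \<in> ?G" "f = filling_of P ?R g" by (rule imageE)
      then show "f \<in> ?F" using mem[of g] by (simp only:)
    qed
  qed
qed

section \<open>Chains and their weights\<close>

lemma bounding_rectangle_subset_iff:
  assumes "hv_convex P" "u \<in> P" "l \<in> P"
  shows "bounding_rectangle u l \<subseteq> P \<longleftrightarrow> (fst u, snd l) \<in> P \<and> (fst l, snd u) \<in> P"
proof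
  assume "bounding_rectangle u l \<subseteq> P"
  then show "(fst u, snd l) \<in> P \<and> (fst l, snd u) \<in> P"
    by (auto simp: bounding_rectangle_def)
next
  assume c: "(fst u, snd l) \<in> P \<and> (fst l, snd u) \<in> P"
  have conv: "\<lbrakk>(r, c) \<in> P; (r, c') \<in> P; c \<le> k; k \<le> c'\<rbrakk> \<Longrightarrow> (r, k) \<in> P"
    "\<lbrakk>(r, c) \<in> P; (r', c) \<in> P; r \<le> k; k \<le> r'\<rbrakk> \<Longrightarrow> (k, c) \<in> P" for r r' c c' k
    using assms(1) unfolding hv_convex_def by blast+
  have rowc: "(r, k) \<in> P" if "(r, c) \<in> P" "(r, c') \<in> P" "min c c' \<le> k" "k \<le> max c c'" for r c c' k
    using conv(1)[of r c c' k] conv(1)[of r c' c k] that by (cases "c \<le> c'") simp_all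
  have colc: "(k, c) \<in> P" if "(r, c) \<in> P" "(r', c) \<in> P" "min r r' \<le> k" "k \<le> max r r'" for r r' c k
    using conv(2)[of r c r' k] conv(2)[of r' c r k] that by (cases "r \<le> r'") simp_all
  show "bounding_rectangle u l \<subseteq> P"
  proof
    fix x assume "x \<in> bounding_rectangle u l"
    then obtain a b where x: "x = (a, b)"
      "min (fst u) (fst l) \<le> a" "a \<le> max (fst u) (fst l)"
      "min (snd u) (snd l) \<le> b" "b \<le> max (snd u) (snd l)"
      by (auto simp: bounding_rectangle_def)
    \<comment> \<open>Row convexity fills the upper and lower edges of the rectangle; column
      convexity then fills each vertical segment joining them.\<close>
    have "(fst u, b) \<in> P" "(fst l, b) \<in> P"
      using rowc[of "fst u" "snd u" "snd l" b] rowc[of "fst l" "snd u" "snd l" b] assms(2,3) c x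
      by simp_all
    then show "x \<in> P" using colc[of "fst u" b "fst l" a] x by simp
  qed
qed

lemma prod_if_const:
  assumes "finite X"
  shows "(\<Prod>x\<in>X. if Q x then a else (b::'a::comm_semiring_1)) =
     a ^ card {x \<in> X. Q x} * b ^ card {x \<in> X. \<not> Q x}"
proof -
  have "X \<inter> {x. Q x} = {x \<in> X. Q x}" "X \<inter> - {x. Q x} = {x \<in> X. \<not> Q x}" by auto
  then show ?thesis using assms by (simp add: prod.If_cases)
qed

lemma finite_chains:
  assumes "finite P"
  shows "finite (ne_chains P f)" "finite (se_chains P f)"
proof -
  have "ne_chains P f \<subseteq> P \<times> P" "se_chains P f \<subseteq> P \<times> P"
    by (auto simp: ne_chains_def se_chains_def one_cells_def)
  then show "finite (ne_chains P f)" "finite (se_chains P f)"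
    using assms finite_subset by blast+
qed

text \<open>Sending a row \<open>r\<close> to its 1-cell \<open>(r, g r)\<close> turns
  \<open>chain_pairs\<close> into the disjoint union of the NE and SE chains, so the product of
  factors becomes two powers that count chains.\<close>

lemma weight_filling_of:
  assumes "hv_convex P" "finite P" "finite R" and g: "\<And>r. r \<in> R \<Longrightarrow> (r, g r) \<in> P"
    and f: "f = filling_of P R g"
  shows "weight p q t (\<lambda>c. {r. (r, c) \<in> P}) R g =
     p ^ (card {(u, l) \<in> ne_chains P f. t (fst u) (fst l)} +
          card {(u, l) \<in> se_chains P f. \<not> t (fst u) (fst l)}) *
     q ^ (card {(u, l) \<in> ne_chains P f. \<not> t (fst u) (fst l)} +
          card {(u, l) \<in> se_chains P f. t (fst u) (fst l)})"
proof -
  let ?D = "chain_pairs (\<lambda>c. {r. (r, c) \<in> P}) R g"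
  let ?h = "\<lambda>(r, r'). ((r, g r), (r', g r'))"
  let ?T = "\<lambda>x. t (fst (fst x)) (fst (snd x))"
  have O: "one_cells P f = (\<lambda>r. (r, g r)) ` R"
    unfolding f by (rule one_cells_filling_of) (rule g)
  have rect: "bounding_rectangle (r, g r) (r', g r') \<subseteq> P \<longleftrightarrow> (r, g r') \<in> P \<and> (r', g r) \<in> P"
    if "r \<in> R" "r' \<in> R" for r r'
    using bounding_rectangle_subset_iff[OF assms(1) g[OF that(1)] g[OF that(2)]] by simp
  have chains: "ne_chains P f \<union> se_chains P f = ?h ` ?D"
  proof (intro equalityI subsetI)
    fix x assume "x \<in> ne_chains P f \<union> se_chains P f"
    then obtain r r' where x: "x = ?h (r, r')" "r \<in> R" "r' \<in> R" "r < r'" "g r \<noteq> g r'"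
      "bounding_rectangle (r, g r) (r', g r') \<subseteq> P"
      by (auto simp: ne_chains_def se_chains_def O)
    then have "(r, r') \<in> ?D" using rect[OF x(2,3)] by (simp add: chain_pairs_def)
    then show "x \<in> ?h ` ?D" using x(1) by blast
  next
    fix x assume "x \<in> ?h ` ?D"
    then obtain r r' where x: "x = ?h (r, r')" "(r, r') \<in> ?D" by auto
    then have "r \<in> R" "r' \<in> R" "r < r'" "g r \<noteq> g r'" "bounding_rectangle (r, g r) (r', g r') \<subseteq> P"
      using rect[of r r'] by (auto simp: chain_pairs_def)
    then show "x \<in> ne_chains P f \<union> se_chains P f"
      using x(1) by (auto simp: ne_chains_def se_chains_def O)
  qed
  have inj: "inj_on ?h ?D" by (auto simp: inj_on_def)
  have fin: "finite (ne_chains P f)" "finite (se_chains P f)"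
    using finite_chains assms(2) by auto
  have "weight p q t (\<lambda>c. {r. (r, c) \<in> P}) R g =
      (\<Prod>x\<in>?h ` ?D. if (snd (snd x) < snd (fst x)) = ?T x then p else q)"
    unfolding weight_def by (subst prod.reindex[OF inj]) (auto intro!: prod.cong)
  also have "\<dots> = (\<Prod>x\<in>ne_chains P f. if (snd (snd x) < snd (fst x)) = ?T x then p else q) *
      (\<Prod>x\<in>se_chains P f. if (snd (snd x) < snd (fst x)) = ?T x then p else q)"
    unfolding chains[symmetric]
    by (rule prod.union_disjoint[OF fin]) (auto simp: ne_chains_def se_chains_def)
  also have "(\<Prod>x\<in>ne_chains P f. if (snd (snd x) < snd (fst x)) = ?T x then p else q) =
      (\<Prod>x\<in>ne_chains P f. if ?T x then p else q)"
    by (rule prod.cong) (auto simp: ne_chains_def)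
  also have "(\<Prod>x\<in>se_chains P f. if (snd (snd x) < snd (fst x)) = ?T x then p else q) =
      (\<Prod>x\<in>se_chains P f. if ?T x then q else p)"
    by (rule prod.cong) (auto simp: se_chains_def)
  finally show ?thesis
    unfolding prod_if_const[OF fin(1)] prod_if_const[OF fin(2)] power_add
    by (simp add: case_prod_unfold mult_ac)
qed

section \<open>The statistics \<open>alpha\<close> and \<open>beta\<close> in row
  coordinates\<close>

lemma fst_in_rows_of_iff:
  assumes "u \<in> P"
  shows "u \<in> rows_of P S \<longleftrightarrow> fst u \<in> fst ` rows_of P S"
  using assms by (auto simp: rows_of_def row_def)

lemma rows_of_all:
  assumes "finite P"
  shows "rows_of P {1..num_rows P} = P"
proof
  show "P \<subseteq> rows_of P {1..num_rows P}"
  proof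
    fix x assume x: "x \<in> P"
    have "bij_betw (\<lambda>i. sorted_list_of_set (fst ` P) ! (i - 1)) {1..num_rows P} (fst ` P)"
      unfolding num_rows_def using assms by (intro bij_betw_sorted_list_of_set_nth) auto
    then have "fst x \<in> (\<lambda>i. sorted_list_of_set (fst ` P) ! (i - 1)) ` {1..num_rows P}"
      using x by (auto simp: bij_betw_def)
    then show "x \<in> rows_of P {1..num_rows P}" using x by (auto simp: rows_of_def row_def)
  qed
qed (auto simp: rows_of_def row_def)

text \<open>Different labels name disjoint rows and all labels together exhaust \<open>P\<close>, so
  complementing labels complements cells.\<close>

lemma rows_of_compl_rows:
  assumes "finite P" "S \<subseteq> {1..num_rows P}"
  shows "rows_of P (compl_rows P S) = P - rows_of P S"
proof -
  have inj: "inj_on (\<lambda>i. sorted_list_of_set (fst ` P) ! (i - 1)) {1..num_rows P}"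
    unfolding num_rows_def using assms bij_betw_sorted_list_of_set_nth bij_betw_imp_inj_on by blast
  have "row P i \<inter> row P j = {}" if "i \<in> {1..num_rows P}" "j \<in> {1..num_rows P}" "i \<noteq> j" for i j
    using inj_onD[OF inj, of i j] that by (auto simp: row_def)
  then have "rows_of P (compl_rows P S) \<inter> rows_of P S = {}"
    using assms(2) unfolding rows_of_def compl_rows_def by blast
  moreover have "rows_of P (compl_rows P S) \<union> rows_of P S = P"
  proof -
    have "compl_rows P S \<union> S = {1..num_rows P}"
      using assms(2) by (auto simp: compl_rows_def)
    then show ?thesis
      using rows_of_all[OF assms(1)] unfolding rows_of_def by (simp flip: UN_Un)
  qed
  ultimately show ?thesis by blast
qed

lemma compl_rows_compl_rows: "S \<subseteq> {1..num_rows P} \<Longrightarrow> compl_rows P (compl_rows P S) = S"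
  by (auto simp: compl_rows_def)

lemma chain_cells:
  assumes "(u, l) \<in> ne_chains P f \<or> (u, l) \<in> se_chains P f"
  shows "u \<in> P" "l \<in> P"
  using assms one_cells_subset by (auto simp: ne_chains_def se_chains_def)

text \<open>These are the exponents in \<open>weight_filling_of\<close> for \<open>t r r'\<close>
  meaning that \<open>r\<close> lies in \<open>T\<close>; complementing \<open>S\<close> negates
  \<open>t\<close>.\<close>

lemma alpha_row_set:
  fixes P S defines "T \<equiv> fst ` rows_of P S"
  assumes "finite P" "S \<subseteq> {1..num_rows P}"
  shows "alpha P S f = card {(u, l) \<in> ne_chains P f. fst u \<in> T} +
           card {(u, l) \<in> se_chains P f. fst u \<notin> T}"
    and "alpha P (compl_rows P S) f = card {(u, l) \<in> ne_chains P f. fst u \<notin> T} +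
           card {(u, l) \<in> se_chains P f. fst u \<in> T}"
proof -
  have T: "x \<in> rows_of P S \<longleftrightarrow> fst x \<in> T" "x \<in> rows_of P (compl_rows P S) \<longleftrightarrow> fst x \<notin> T"
    if "x \<in> P" for x
    using that fst_in_rows_of_iff rows_of_compl_rows[OF assms(2,3)] unfolding T_def by auto
  have "{(u, l) \<in> X. u \<in> rows_of P S} = {(u, l) \<in> X. fst u \<in> T}"
    "{(u, l) \<in> X. u \<in> rows_of P (compl_rows P S)} = {(u, l) \<in> X. fst u \<notin> T}"
    if "X = ne_chains P f \<or> X = se_chains P f" for X
  proof -
    have *: "(u \<in> rows_of P S) = (fst u \<in> T)" "(u \<in> rows_of P (compl_rows P S)) = (fst u \<notin> T)"
      if "(u, l) \<in> X" for u l
      using T chain_cells(1) \<open>X = ne_chains P f \<or> X = se_chains P f\<close> that by blast+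
    show "{(u, l) \<in> X. u \<in> rows_of P S} = {(u, l) \<in> X. fst u \<in> T}"
      "{(u, l) \<in> X. u \<in> rows_of P (compl_rows P S)} = {(u, l) \<in> X. fst u \<notin> T}"
      using * by (safe; blast)+
  qed
  then show "alpha P S f = card {(u, l) \<in> ne_chains P f. fst u \<in> T} +
           card {(u, l) \<in> se_chains P f. fst u \<notin> T}"
    "alpha P (compl_rows P S) f = card {(u, l) \<in> ne_chains P f. fst u \<notin> T} +
           card {(u, l) \<in> se_chains P f. fst u \<in> T}"
    unfolding alpha_def compl_rows_compl_rows[OF assms(3)] by simp_all
qed

text \<open>The counterpart with \<open>t r r'\<close> meaning that \<open>r'\<close> lies in
  \<open>T\<close>.\<close>

lemma beta_row_set:
  fixes P S defines "T \<equiv> fst ` rows_of P S"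
  assumes "finite P" "S \<subseteq> {1..num_rows P}"
  shows "beta P S f = card {(u, l) \<in> ne_chains P f. fst l \<in> T} +
           card {(u, l) \<in> se_chains P f. fst l \<notin> T}"
    and "beta P (compl_rows P S) f = card {(u, l) \<in> ne_chains P f. fst l \<notin> T} +
           card {(u, l) \<in> se_chains P f. fst l \<in> T}"
proof -
  have T: "x \<in> rows_of P S \<longleftrightarrow> fst x \<in> T" "x \<in> rows_of P (compl_rows P S) \<longleftrightarrow> fst x \<notin> T"
    if "x \<in> P" for x
    using that fst_in_rows_of_iff rows_of_compl_rows[OF assms(2,3)] unfolding T_def by auto
  have "{(u, l) \<in> X. l \<in> rows_of P S} = {(u, l) \<in> X. fst l \<in> T}"
    "{(u, l) \<in> X. l \<in> rows_of P (compl_rows P S)} = {(u, l) \<in> X. fst l \<notin> T}"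
    if "X = ne_chains P f \<or> X = se_chains P f" for X
  proof -
    have *: "(l \<in> rows_of P S) = (fst l \<in> T)" "(l \<in> rows_of P (compl_rows P S)) = (fst l \<notin> T)"
      if "(u, l) \<in> X" for u l
      using T chain_cells(2) \<open>X = ne_chains P f \<or> X = se_chains P f\<close> that by blast+
    show "{(u, l) \<in> X. l \<in> rows_of P S} = {(u, l) \<in> X. fst l \<in> T}"
      "{(u, l) \<in> X. l \<in> rows_of P (compl_rows P S)} = {(u, l) \<in> X. fst l \<notin> T}"
      using * by (safe; blast)+
  qed
  then show "beta P S f = card {(u, l) \<in> ne_chains P f. fst l \<in> T} +
           card {(u, l) \<in> se_chains P f. fst l \<notin> T}"
    "beta P (compl_rows P S) f = card {(u, l) \<in> ne_chains P f. fst l \<notin> T} +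
           card {(u, l) \<in> se_chains P f. fst l \<in> T}"
    unfolding beta_def compl_rows_compl_rows[OF assms(3)] by simp_all
qed

text \<open>\<open>R\<close> and \<open>s'\<close> are obtained before \<open>h\<close> is chosen,
  so that sums with different weights can be compared over the same placements.\<close>

lemma sum_fillings_eq_sum_placements:
  assumes P: "finite P" and e: "\<forall>i\<in>{1..num_rows P}. e i \<in> {0, 1}"
  obtains R s' where "finite R"
    "\<forall>h :: (cell \<Rightarrow> nat) \<Rightarrow> 'a::comm_monoid_add. (\<Sum>f\<in>fillings_with P e s. h f) =
       (\<Sum>g\<in>placements s' (\<lambda>c. {r. (r, c) \<in> P}) (snd ` P) R. h (filling_of P R g))"
proof -
  obtain e' s' where e': "\<forall>r\<in>fst ` P. e' r \<in> {0, 1}"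
    and F: "fillings_with P e s = {f \<in> P \<rightarrow>\<^sub>E {0, 1}.
       (\<forall>r\<in>fst ` P. card {c. (r, c) \<in> one_cells P f} = e' r) \<and>
       (\<forall>c\<in>snd ` P. card {r. (r, c) \<in> one_cells P f} = s' c)}"
    by (rule fillings_with_relabel[OF assms, where s = s])
  show thesis
  proof (rule that)
    show "finite {r \<in> fst ` P. e' r = 1}" using P by simp
    show "\<forall>h :: (cell \<Rightarrow> nat) \<Rightarrow> 'a. (\<Sum>f\<in>fillings_with P e s. h f) =
       (\<Sum>g\<in>placements s' (\<lambda>c. {r. (r, c) \<in> P}) (snd ` P) {r \<in> fst ` P. e' r = 1}.
          h (filling_of P {r \<in> fst ` P. e' r = 1} g))"
      unfolding F by (intro allI sum.reindex_bij_betw[symmetric] bij_betw_filling_of P e')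
  qed
qed

lemma moon_polyomino_columns:
  assumes "moon_polyomino P"
  shows "{r. (r, c) \<in> P} \<subseteq> {r. (r, c') \<in> P} \<or> {r. (r, c') \<in> P} \<subseteq> {r. (r, c) \<in> P}"
    and "\<lbrakk>c \<le> k; k \<le> c'\<rbrakk> \<Longrightarrow> {r. (r, c) \<in> P} \<inter> {r. (r, c') \<in> P} \<subseteq> {r. (r, k) \<in> P}"
proof -
  show "{r. (r, c) \<in> P} \<subseteq> {r. (r, c') \<in> P} \<or> {r. (r, c') \<in> P} \<subseteq> {r. (r, c) \<in> P}"
    using assms unfolding moon_polyomino_def intersection_free_def by blast
  have "\<forall>r c c' k. (r, c) \<in> P \<and> (r, c') \<in> P \<and> c \<le> k \<and> k \<le> c' \<longrightarrow> (r, k) \<in> P"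
    using assms unfolding moon_polyomino_def hv_convex_def by (elim conjE)
  then show "{r. (r, c) \<in> P} \<inter> {r. (r, c') \<in> P} \<subseteq> {r. (r, k) \<in> P}" if "c \<le> k" "k \<le> c'"
    using that by blast
qed

text \<open>Both sums run over the same fillings, so \<open>sum_weight_eq\<close> is applied with
  equal row sets and only the rule \<open>t\<close> changes.\<close>

lemma sum_mixed_eq:
  fixes p q :: "'a::comm_semiring_1"
  assumes P: "moon_polyomino P" and e: "\<forall>i\<in>{1..num_rows P}. e i \<in> {0, 1}"
    and os: "one_sided t" "one_sided t'"
  defines "a \<equiv> \<lambda>t f. card {(u, l) \<in> ne_chains P f. t (fst u) (fst l)} +
          card {(u, l) \<in> se_chains P f. \<not> t (fst u) (fst l)}"
    and "b \<equiv> \<lambda>t f. card {(u, l) \<in> ne_chains P f. \<not> t (fst u) (fst l)} +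
          card {(u, l) \<in> se_chains P f. t (fst u) (fst l)}"
  shows "(\<Sum>f\<in>fillings_with P e s. p ^ a t f * q ^ b t f) =
     (\<Sum>f\<in>fillings_with P e s. p ^ a t' f * q ^ b t' f)"
proof -
  have fin: "finite P" and conv: "hv_convex P"
    using P by (auto simp: moon_polyomino_def polyomino_def)
  let ?I = "\<lambda>c. {r. (r, c) \<in> P}"
  obtain R s' where R: "finite R"
    "\<forall>h :: (cell \<Rightarrow> nat) \<Rightarrow> 'a. (\<Sum>f\<in>fillings_with P e s. h f) =
       (\<Sum>g\<in>placements s' ?I (snd ` P) R. h (filling_of P R g))"
    by (rule sum_fillings_eq_sum_placements[OF fin e, where s = s])
  have w: "(\<Sum>f\<in>fillings_with P e s. p ^ a t f * q ^ b t f) =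
      (\<Sum>g\<in>placements s' ?I (snd ` P) R. weight p q t ?I R g)" for t
    unfolding R(2)[rule_format] a_def b_def
    by (intro sum.cong refl weight_filling_of[symmetric] conv fin R(1))
       (auto simp: placements_def)
  show ?thesis
    unfolding w
    by (rule sum_weight_eq) (use fin R(1) os moon_polyomino_columns[OF P] in auto)
qed

theorem theorem2p1:
  fixes P :: "cell set" and n m :: nat and e s :: "nat \<Rightarrow> nat"
    and p q :: "'a::comm_semiring_1"
  assumes "moon_polyomino P"
    and "n = num_rows P" and "m = num_cols P"
    and "\<forall>i\<in>{1..n}. e i \<in> {0, 1}"
    and "(\<Sum>i=1..n. e i) = (\<Sum>j=1..m. s j)"
  shows "(\<forall>S S'. S \<subseteq> {1..n} \<longrightarrow> S' \<subseteq> {1..n} \<longrightarrow> F_top P e s S p q = F_top P e s S' p q) \<and>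
         (\<forall>S. S \<subseteq> {1..n} \<longrightarrow>
            F_top P e s S p q = F_top P e s {} p q \<and>
            F_top P e s {} p q = (\<Sum>f\<in>fillings_with P e s. p ^ se P f * q ^ ne P f) \<and>
            F_top P e s S p q = F_top P e s S q p) \<and>
         (\<forall>S S'. S \<subseteq> {1..n} \<longrightarrow> S' \<subseteq> {1..n} \<longrightarrow> F_bot P e s S p q = F_bot P e s S' p q) \<and>
         (\<forall>S. S \<subseteq> {1..n} \<longrightarrow>
            F_bot P e s S p q = F_bot P e s {} p q \<and>
            F_bot P e s {} p q = (\<Sum>f\<in>fillings_with P e s. p ^ se P f * q ^ ne P f) \<and>
            F_bot P e s S p q = F_bot P e s S q p)"
proof -
  have P: "finite P" using assms(1) by (simp add: moon_polyomino_def polyomino_def)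
  have e: "\<forall>i\<in>{1..num_rows P}. e i \<in> {0, 1}" using assms by simp
  have os: "one_sided (\<lambda>r r'. r \<in> T)" "one_sided (\<lambda>r r'. r' \<in> T)" for T :: "int set"
    by (auto simp: one_sided_def)
  have top: "F_top P e s S p q = F_top P e s S' p q"
    if "S \<subseteq> {1..n}" "S' \<subseteq> {1..n}" for S S'
    using that sum_mixed_eq[OF assms(1) e os(1) os(1)]
    unfolding F_top_def assms(2) by (simp add: alpha_row_set[OF P])
  have bot: "F_bot P e s S p q = F_bot P e s S' p q"
    if "S \<subseteq> {1..n}" "S' \<subseteq> {1..n}" for S S'
    using that sum_mixed_eq[OF assms(1) e os(2) os(2)]
    unfolding F_bot_def assms(2) by (simp add: beta_row_set[OF P])
  have compl: "compl_rows P S \<subseteq> {1..n}" for S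
    using assms(2) by (auto simp: compl_rows_def)
  \<comment> \<open>Exchanging \<open>p\<close> and \<open>q\<close> swaps the exponents belonging
    to \<open>S\<close> and its complement, and complementing twice gives back
    \<open>S\<close>.\<close>
  have sym: "F_top P e s S q p = F_top P e s (compl_rows P S) p q"
    "F_bot P e s S q p = F_bot P e s (compl_rows P S) p q" if "S \<subseteq> {1..n}" for S
    using that assms(2) by (simp_all add: F_top_def F_bot_def compl_rows_compl_rows mult.commute)
  have no_rows: "rows_of P {} = {}" by (simp add: rows_of_def)
  have split_triv: "{(u, l). (u, l) \<in> X} = X" for X :: "(cell \<times> cell) set" by auto
  \<comment> \<open>For empty \<open>S\<close> the row set is empty, so every SE chain counts
    towards \<open>p\<close> and every NE chain towards \<open>q\<close>.\<close>
  have "F_top P e s {} p q = (\<Sum>f\<in>fillings_with P e s. p ^ se P f * q ^ ne P f)"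
    unfolding F_top_def by (simp add: alpha_row_set[OF P] no_rows split_triv se_def ne_def)
  moreover have "F_bot P e s {} p q = (\<Sum>f\<in>fillings_with P e s. p ^ se P f * q ^ ne P f)"
    unfolding F_bot_def by (simp add: beta_row_set[OF P] no_rows split_triv se_def ne_def)
  moreover have "F_top P e s S p q = F_top P e s S q p" "F_bot P e s S p q = F_bot P e s S q p"
    if "S \<subseteq> {1..n}" for S
    using top[OF that compl] bot[OF that compl] sym[OF that] by simp_all
  ultimately show ?thesis
    using top bot by blast
qed

end
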